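(* Let $a,b>0$, $x_0\in\mathbb{R}$, and let $\mathcal{A}$, $\mathcal{B}$, the linear estimators $L_n$, the linear minimax risk $R(n,\mathcal{A},\mathcal{B})$ and the central finite-difference (CFD) estimator $\bar L_n$ be as defined in the context. Then for every integer $n\ge 1$, $$R(n,\mathcal{A},\mathcal{B})\ \ge\ \left(\frac{3a^{2}b^{2}}{16}\right)^{1/3}n^{-2/3}.$$ Moreover, if $n$ is even, the CFD estimator $\bar L_n$ with $\delta=\left(\frac{18b}{a^{2}}\right)^{1/6}n^{-1/6}$ satisfies $$\sup_{f\in\mathcal{A},\ \sigma^2\in\mathcal{B}}E\big(\bar L_n-f'(x_0)\big)^2=\left(\frac{3a^{2}b^{2}}{16}\right)^{1/3}n^{-2/3},$$ and it is therefore the best linear estimator for the problem class $(\mathcal{A},\mathcal{B})$, i.e. its worst-case mean squared error equals $R(n,\mathcal{A},\mathcal{B})$.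
   Context: Setting. $f:\mathbb{R}\to\mathbb{R}$ is an unknown function; for any chosen $x\in\mathbb{R}$ one can observe a random variable $Y(x)$ with $E[Y(x)]=f(x)$ and $Var(Y(x))=\sigma^2(x)$. The goal is to estimate $f'(x_0)$ at a fixed $x_0\in\mathbb{R}$. With budget $n\ge1$, one chooses deterministic perturbations $\delta_1,\dots,\delta_n\in\mathbb{R}$ (repetitions allowed) and observes independent outputs $Y_j(x_0+\delta_j)$, $j=1,\dots,n$. Linear estimators: $L_n=\sum_{j=1}^n w_jY_j(x_0+\delta_j)$ with deterministic weights $w_j\in\mathbb{R}$. CFD estimator ($n$ even, $\delta>0$): $$\bar L_n=\frac{1}{n/2}\sum_{j=1}^{n/2}\frac{Y_{2j-1}(x_0+\delta)-Y_{2j}(x_0-\delta)}{2\delta}.$$ Problem classes, for given constants $a,b>0$: $\mathcal{A}$ is the set of functions $f:\mathbb{R}\to\mathbb{R}$ such that $f^{(2)}(x_0)$ exists and, for all $x\in\mathbb{R}$, $$\left|f(x)-f(x_0)-f'(x_0)(x-x_0)-\tfrac{f^{(2)}(x_0)}{2}(x-x_0)^2\right|\le\tfrac{a}{6}|x-x_0|^3 .$$ $\mathcal{B}$ is the set of variance functions $\sigma^2:\mathbb{R}\to[0,\infty)$ with $\sigma^2(x)\le b$ for all $x$. Linear minimax risk: $$R(n,\mathcal{A},\mathcal{B})=\inf_{\delta_1,\dots,\delta_n,\ w_1,\dots,w_n\in\mathbb{R}}\ \ \sup_{f\in\mathcal{A},\ \sigma^2\in\mathcal{B}}E\big(L_n-f'(x_0)\big)^2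 .$$ (The mean squared error of a linear estimator depends on the law of the outputs only through $f$ and $\sigma^2$.) *)

theory Defs
  imports "HOL-Probability.Probability"
begin

text \<open>\<open>deriv\<close> is total, so existence of the second derivative at \<open>x0\<close> is stated separately: \<open>f\<close> is
  differentiable near \<open>x0\<close> and its derivative is differentiable at \<open>x0\<close>.\<close>

definition func_class :: "real \<Rightarrow> real \<Rightarrow> (real \<Rightarrow> real) set" where
  "func_class a x0 = {f.
     (\<forall>\<^sub>F x in nhds x0. f differentiable (at x)) \<and>
     (deriv f) differentiable (at x0) \<and>
     (\<forall>x. \<bar>f x - f x0 - deriv f x0 * (x - x0) - (deriv ^^ 2) f x0 / 2 * (x - x0) ^ 2\<bar>
            \<le> a / 6 * \<bar>x - x0\<bar> ^ 3)}"

definition var_class :: "real \<Rightarrow> (real \<Rightarrow> real) set" where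
  "var_class b = {v. \<forall>x. 0 \<le> v x \<and> v x \<le> b}"

text \<open>\<open>\<mu> x\<close> is the law of the output \<open>Y(x)\<close>.\<close>

definition output_laws :: "(real \<Rightarrow> real) \<Rightarrow> (real \<Rightarrow> real) \<Rightarrow> (real \<Rightarrow> real measure) set" where
  "output_laws f v = {\<mu>. \<forall>x.
     prob_space (\<mu> x) \<and> sets (\<mu> x) = sets borel \<and> integrable (\<mu> x) (\<lambda>y. y ^ 2) \<and>
     prob_space.expectation (\<mu> x) (\<lambda>y. y) = f x \<and>
     prob_space.variance (\<mu> x) (\<lambda>y. y) = v x}"

text \<open>Mean squared error, as an estimator of \<open>\<theta>\<close>, of the statistic \<open>T\<close> of the \<open>n\<close> independent outputs
  \<open>Y\<^sub>j(x0 + \<delta>\<^sub>j)\<close>, which are the coordinates of the product space. The worst case of a linear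
  estimator may be infinite, hence values in \<open>ennreal\<close>.\<close>

definition mse ::
  "nat \<Rightarrow> real \<Rightarrow> (real \<Rightarrow> real measure) \<Rightarrow> real \<Rightarrow> (nat \<Rightarrow> real) \<Rightarrow> ((nat \<Rightarrow> real) \<Rightarrow> real) \<Rightarrow> ennreal" where
  "mse n x0 \<mu> \<theta> \<delta> T =
     (\<integral>\<^sup>+ y. ennreal ((T y - \<theta>) ^ 2) \<partial>(PiM {1..n} (\<lambda>j. \<mu> (x0 + \<delta> j))))"

lemma mse_eq_of_indep:
  assumes "prob_space M" and "n \<ge> 1"
    and "prob_space.indep_vars M (\<lambda>_. borel) Y {1..n}"
    and "\<And>j. j \<in> {1..n} \<Longrightarrow> distr M borel (Y j) = \<mu> (x0 + \<delta> j)"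
    and "T \<in> borel_measurable (PiM {1..n} (\<lambda>_. borel))"
  shows "mse n x0 \<mu> \<theta> \<delta> T
    = (\<integral>\<^sup>+ \<omega>. ennreal ((T (\<lambda>j\<in>{1..n}. Y j \<omega>) - \<theta>) ^ 2) \<partial>M)"
proof -
  interpret prob_space M by fact
  have rv: "random_variable borel (Y j)" if "j \<in> {1..n}" for j
    using assms(3) that unfolding indep_vars_def by blast
  have *: "distr M (PiM {1..n} (\<lambda>_. borel)) (\<lambda>\<omega>. \<lambda>j\<in>{1..n}. Y j \<omega>)
      = PiM {1..n} (\<lambda>j. distr M borel (Y j))"
    using assms(2,3) rv by (subst (asm) indep_vars_iff_distr_eq_PiM') auto
  also have "\<dots> = PiM {1..n} (\<lambda>j. \<mu> (x0 + \<delta> j))"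
    by (rule PiM_cong) (use assms(4) in auto)
  finally have D: "PiM {1..n} (\<lambda>j. \<mu> (x0 + \<delta> j))
      = distr M (PiM {1..n} (\<lambda>_. borel)) (\<lambda>\<omega>. \<lambda>j\<in>{1..n}. Y j \<omega>)" by simp
  have m: "(\<lambda>\<omega>. \<lambda>j\<in>{1..n}. Y j \<omega>) \<in> M \<rightarrow>\<^sub>M PiM {1..n} (\<lambda>_. borel)"
    using rv by (intro measurable_restrict) auto
  have t: "(\<lambda>y. ennreal ((T y - \<theta>) ^ 2)) \<in> borel_measurable (PiM {1..n} (\<lambda>_. borel))"
    using assms(5) by measurable
  show ?thesis
    unfolding mse_def D using m t by (subst nn_integral_distr) auto
qed

definition worst_case_mse ::
  "real \<Rightarrow> real \<Rightarrow> real \<Rightarrow> nat \<Rightarrow> (nat \<Rightarrow> real) \<Rightarrow> ((nat \<Rightarrow> real) \<Rightarrow> real) \<Rightarrow> ennreal" where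
  "worst_case_mse a b x0 n \<delta> T =
     (SUP f \<in> func_class a x0. SUP v \<in> var_class b. SUP \<mu> \<in> output_laws f v.
        mse n x0 \<mu> (deriv f x0) \<delta> T)"

definition linear_estimator :: "nat \<Rightarrow> (nat \<Rightarrow> real) \<Rightarrow> (nat \<Rightarrow> real) \<Rightarrow> real" where
  "linear_estimator n w y = (\<Sum>j = 1..n. w j * y j)"

definition linear_minimax_risk :: "real \<Rightarrow> real \<Rightarrow> real \<Rightarrow> nat \<Rightarrow> ennreal" where
  "linear_minimax_risk a b x0 n =
     (INF \<delta> \<in> UNIV. INF w \<in> UNIV. worst_case_mse a b x0 n \<delta> (linear_estimator n w))"

definition cfd_design :: "real \<Rightarrow> nat \<Rightarrow> real" where
  "cfd_design d j = (if odd j then d else - d)"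

definition cfd_estimator :: "nat \<Rightarrow> real \<Rightarrow> (nat \<Rightarrow> real) \<Rightarrow> real" where
  "cfd_estimator n d y =
     1 / (real n / 2) * (\<Sum>j = 1..n div 2. (y (2 * j - 1) - y (2 * j)) / (2 * d))"

lemma cfd_estimator_linear:
  assumes "even n"
  shows "cfd_estimator n d
    = linear_estimator n (\<lambda>j. (if odd j then 1 else -1) / (real n * d))"
proof
  fix y :: "nat \<Rightarrow> real"
  from assms obtain m where n: "n = 2 * m" by blast
  have "(\<Sum>j = 1..2 * m. (if odd j then 1 else -1) * y j)
      = (\<Sum>j = 1..m. y (2 * j - 1) - y (2 * j))"
    by (induction m) auto
  then show "cfd_estimator n d y
      = linear_estimator n (\<lambda>j. (if odd j then 1 else -1) / (real n * d)) y"
    by (simp add: cfd_estimator_def linear_estimator_def n sum_divide_distrib[symmetric])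
qed

end

theory Submission
  imports Defs
begin

text \<open>For a linear estimator the mean squared error is \<open>bias\<^sup>2 + \<Sum> w\<^sub>j\<^sup>2 \<sigma>\<^sup>2(x0 + \<delta>\<^sub>j)\<close>.

  Lower bound: fix \<open>t > 0\<close>. Among the functions in the class with \<open>f x0 = f'' x0 = 0\<close> and
  \<open>f' x0 = t\<close>, the one closest to zero is \<open>t (x - x0) - a/6 (x - x0)\<^sup>3\<close>, cut off to \<open>0\<close> beyond
  its zeros; its square is at most \<open>8 t\<^sup>3 / (9 a)\<close>. Whatever the design, the Cauchy-Schwarz inequality
  therefore forces bias or variance to be large, and \<open>t\<^sup>3 = 9 a b / (4 n)\<close> is the best choice.

  Upper bound: the central difference cancels the quadratic term, so its bias is at most
  \<open>a d\<^sup>2 / 6\<close>, while its variance is at most \<open>b / (n d\<^sup>2)\<close>; the given \<open>d\<close> balances the two to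
  exactly the lower bound.\<close>

section \<open>Mean squared error of linear estimators\<close>

text \<open>Independence in the form used below: with factor 1 on all but one or two coordinates, it
  gives the first and second mixed moments on the product space.\<close>

lemma has_bochner_integral_PiM_prod:
  fixes f :: "'i \<Rightarrow> 'a \<Rightarrow> real"
  assumes "finite I" and "\<And>i. prob_space (M i)" and "\<And>i. i \<in> I \<Longrightarrow> integrable (M i) (f i)"
  shows "has_bochner_integral (PiM I M) (\<lambda>x. \<Prod>i\<in>I. f i (x i)) (\<Prod>i\<in>I. integral\<^sup>L (M i) (f i))"
proof -
  interpret product_sigma_finite M
    by (rule product_sigma_finite.intro) (simp add: assms(2) prob_space_imp_sigma_finite)
  show ?thesis
    using product_integrable_prod[OF assms(1,3)] product_integral_prod[OF assms(1,3)]
    by (simp add: has_bochner_integral_iff)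
qed

text \<open>Bias-variance decomposition. After centring each coordinate, the linear terms have mean
  zero and, by independence, only the diagonal of the double sum survives.\<close>

lemma nn_integral_PiM_linear_square_error:
  fixes M :: "'i \<Rightarrow> real measure" and w :: "'i \<Rightarrow> real"
  assumes fin: "finite I" and prob: "\<And>i. prob_space (M i)"
    and sets: "\<And>i. sets (M i) = sets borel"
    and sq: "\<And>i. integrable (M i) (\<lambda>y. y ^ 2)"
  defines "m \<equiv> \<lambda>i. integral\<^sup>L (M i) (\<lambda>y. y)"
  defines "v \<equiv> \<lambda>i. integral\<^sup>L (M i) (\<lambda>y. (y - m i) ^ 2)"
  shows "(\<integral>\<^sup>+ y. ennreal (((\<Sum>i\<in>I. w i * y i) - \<theta>) ^ 2) \<partial>PiM I M)
    = ennreal (((\<Sum>i\<in>I. w i * m i) - \<theta>) ^ 2 + (\<Sum>i\<in>I. w i ^ 2 * v i))"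
proof -
  have meas: "(\<lambda>y. y) \<in> borel_measurable (M i)" for i
    by (rule measurable_ident_sets) (rule sets)
  have int1: "integrable (M i) (\<lambda>y. y)" for i
  proof -
    interpret prob_space "M i" by (rule prob)
    show ?thesis using square_integrable_imp_integrable[OF meas sq] .
  qed
  have int_c: "integrable (M i) (\<lambda>y. y - m i)" for i
  proof -
    interpret prob_space "M i" by (rule prob)
    show ?thesis using int1 by simp
  qed
  have int_c2: "integrable (M i) (\<lambda>y. (y - m i) ^ 2)" for i
  proof -
    interpret prob_space "M i" by (rule prob)
    have "integrable (M i) (\<lambda>y. y ^ 2 + m i ^ 2 - 2 * y * m i)"
      using int1 sq by simp
    then show ?thesis by (simp add: power2_diff)
  qed
  have one: "integral\<^sup>L (M i) (\<lambda>_. 1::real) = 1" "integrable (M i) (\<lambda>_. 1::real)" for i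
  proof -
    interpret prob_space "M i" by (rule prob)
    show "integral\<^sup>L (M i) (\<lambda>_. 1::real) = 1" "integrable (M i) (\<lambda>_. 1::real)"
      by (simp_all add: prob_space)
  qed
  have mean0: "integral\<^sup>L (M i) (\<lambda>y. y - m i) = 0" for i
  proof -
    interpret prob_space "M i" by (rule prob)
    show ?thesis using int1 by (simp add: m_def prob_space)
  qed
  let ?P = "PiM I M"
  have lin: "has_bochner_integral ?P (\<lambda>y. y i - m i) 0" if i: "i \<in> I" for i
  proof -
    \<comment> \<open>A single coordinate is written as a product over \<open>I\<close>; its factor
      at \<open>i\<close> integrates to 0.\<close>
    let ?f = "\<lambda>k y. if k = i then y - m k else 1"
    have "integrable (M k) (?f k)" for k
      by (cases "k = i") (simp_all add: int_c one)
    then have "has_bochner_integral ?P (\<lambda>y. \<Prod>k\<in>I. ?f k (y k)) (\<Prod>k\<in>I. integral\<^sup>L (M k) (?f k))"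
      by (intro has_bochner_integral_PiM_prod fin prob)
    moreover have "(\<Prod>k\<in>I. integral\<^sup>L (M k) (?f k)) = 0"
      using fin i by (intro prod_zero) (auto simp: mean0 intro!: bexI[of _ i])
    ultimately show ?thesis using fin i by simp
  qed
  have quad: "has_bochner_integral ?P (\<lambda>y. (y i - m i) * (y j - m j)) (if j = i then v i else 0)"
    if i: "i \<in> I" and j: "j \<in> I" for i j
  proof -
    \<comment> \<open>Two indicator-style factors cover both cases: for \<open>i = j\<close> they
      multiply to the square, otherwise they put one centred factor at \<open>i\<close> and one at
      \<open>j\<close>.\<close>
    let ?f = "\<lambda>k y. (if k = i then y - m k else 1) * (if k = j then y - m k else 1)"
    have "integrable (M k) (?f k)" for k
      using int_c2[of k] by (cases "k = i"; cases "k = j") (simp_all add: int_c one power2_eq_square)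
    then have "has_bochner_integral ?P (\<lambda>y. \<Prod>k\<in>I. ?f k (y k)) (\<Prod>k\<in>I. integral\<^sup>L (M k) (?f k))"
      by (intro has_bochner_integral_PiM_prod fin prob)
    moreover have "(\<Prod>k\<in>I. ?f k (y k)) = (y i - m i) * (y j - m j)" for y
      using fin i j by (simp add: prod.distrib)
    moreover have "(\<Prod>k\<in>I. integral\<^sup>L (M k) (?f k)) = (if j = i then v i else 0)"
    proof (cases "j = i")
      case True
      have "integral\<^sup>L (M k) (?f k) = (if k = i then v k else 1)" for k
        using True by (simp add: v_def power2_eq_square prob_space.prob_space[OF prob])
      then show ?thesis using True fin i by simp
    next
      case False
      then show ?thesis
        using fin i by (auto intro!: prod_zero bexI[of _ i] simp: mean0)
    qed
    ultimately show ?thesis by simp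
  qed
  \<comment> \<open>\<open>c\<close> is the bias; the error is \<open>c + U\<close> with
    \<open>U\<close> the centred noise.\<close>
  define c where "c = (\<Sum>i\<in>I. w i * m i) - \<theta>"
  have expand: "((\<Sum>i\<in>I. w i * y i) - \<theta>) ^ 2
    = c ^ 2 + (\<Sum>i\<in>I. 2 * c * w i * (y i - m i))
      + (\<Sum>i\<in>I. \<Sum>j\<in>I. w i * w j * ((y i - m i) * (y j - m j)))" for y
  proof -
    define U where "U = (\<Sum>i\<in>I. w i * (y i - m i))"
    have "(\<Sum>i\<in>I. w i * y i) - \<theta> = c + U"
      by (simp add: c_def U_def right_diff_distrib sum_subtractf)
    moreover have "U * U = (\<Sum>i\<in>I. \<Sum>j\<in>I. w i * w j * ((y i - m i) * (y j - m j)))"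
      unfolding U_def sum_product by (intro sum.cong) (auto simp: algebra_simps)
    moreover have "2 * c * U = (\<Sum>i\<in>I. 2 * c * w i * (y i - m i))"
      unfolding U_def sum_distrib_left by (simp add: algebra_simps)
    ultimately show ?thesis by (simp add: power2_eq_square algebra_simps)
  qed
  interpret P: prob_space ?P
    by (rule prob_space_PiM) (rule prob)
  have "has_bochner_integral ?P (\<lambda>y. c ^ 2 + (\<Sum>i\<in>I. 2 * c * w i * (y i - m i))
      + (\<Sum>i\<in>I. \<Sum>j\<in>I. w i * w j * ((y i - m i) * (y j - m j))))
      (c ^ 2 + (\<Sum>i\<in>I. 2 * c * w i * 0)
      + (\<Sum>i\<in>I. \<Sum>j\<in>I. w i * w j * (if j = i then v i else 0)))"
    by (intro has_bochner_integral_add has_bochner_integral_sum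
        has_bochner_integral_mult_right lin quad)
      (simp_all add: has_bochner_integral_iff P.prob_space)
  moreover have "(\<Sum>j\<in>I. w i * w j * (if j = i then v i else 0)) = w i ^ 2 * v i"
    if "i \<in> I" for i
    using fin that by (simp add: if_distrib power2_eq_square cong: if_cong)
  ultimately have hb: "has_bochner_integral ?P (\<lambda>y. ((\<Sum>i\<in>I. w i * y i) - \<theta>) ^ 2)
      (c ^ 2 + (\<Sum>i\<in>I. w i ^ 2 * v i))"
    unfolding expand by simp
  show ?thesis
    using hb by (subst nn_integral_eq_integral) (auto simp: has_bochner_integral_iff c_def)
qed

lemma mse_linear_estimator:
  assumes "\<mu> \<in> output_laws f v"
  shows "mse n x0 \<mu> \<theta> \<delta> (linear_estimator n w)
    = ennreal (((\<Sum>j = 1..n. w j * f (x0 + \<delta> j)) - \<theta>) ^ 2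
        + (\<Sum>j = 1..n. w j ^ 2 * v (x0 + \<delta> j)))"
proof -
  have *: "prob_space (\<mu> x)" "sets (\<mu> x) = sets borel" "integrable (\<mu> x) (\<lambda>y. y ^ 2)"
    and mean: "integral\<^sup>L (\<mu> x) (\<lambda>y. y) = f x"
    and var: "integral\<^sup>L (\<mu> x) (\<lambda>y. (y - integral\<^sup>L (\<mu> x) (\<lambda>y. y)) ^ 2) = v x" for x
    using assms unfolding output_laws_def by blast+
  show ?thesis
    unfolding mse_def linear_estimator_def
    by (subst nn_integral_PiM_linear_square_error) (simp_all add: * var, simp add: mean)
qed

text \<open>Gaussian outputs show that the supremum over laws is not over the empty set, where it
  would be 0 in \<open>ennreal\<close>. The lower bound evaluates the risk at these laws.\<close>

lemma normal_output_laws: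
  assumes "b > 0"
  shows "(\<lambda>x. density lborel (normal_density (f x) (sqrt b))) \<in> output_laws f (\<lambda>_. b)"
proof -
  have s: "sqrt b > 0" using assms by simp
  have "prob_space N \<and> sets N = sets borel \<and> integrable N (\<lambda>y. y ^ 2) \<and>
      prob_space.expectation N (\<lambda>y. y) = m \<and> prob_space.variance N (\<lambda>y. y) = b"
    if N: "N = density lborel (normal_density m (sqrt b))" for N m
  proof -
    interpret prob_space N
      unfolding N by (rule prob_space_normal_density[OF s])
    have D: "distributed N lborel (\<lambda>y. y) (normal_density m (sqrt b))"
      unfolding distributed_def N by (auto simp: distr_id2)
    \<comment> \<open>Expanding \<open>y ^ 2\<close> around \<open>m\<close> reduces the second
      moment to centred normal moments.\<close>
    have "integrable lborel (\<lambda>y. normal_density m (sqrt b) y * (y - m) ^ 2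
        + 2 * m * (normal_density m (sqrt b) y * (y - m) ^ 1) + m ^ 2 * normal_density m (sqrt b) y)"
      by (intro Bochner_Integration.integrable_add integrable_mult_right
          integrable_normal_moment s integrable_normal_density)
    also have "(\<lambda>y. normal_density m (sqrt b) y * (y - m) ^ 2
        + 2 * m * (normal_density m (sqrt b) y * (y - m) ^ 1) + m ^ 2 * normal_density m (sqrt b) y)
        = (\<lambda>y. normal_density m (sqrt b) y * y ^ 2)"
      by (simp add: fun_eq_iff power2_eq_square algebra_simps)
    finally have "integrable N (\<lambda>y. y ^ 2)"
      unfolding N by (subst integrable_density) (auto simp: normal_density_nonneg)
    moreover have "expectation (\<lambda>y. y) = m"
      by (rule normal_distributed_expectation[OF s D])
    moreover have "variance (\<lambda>y. y) = b"
      using normal_distributed_variance[OF s D] assms by simp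
    ultimately show ?thesis
      using prob_space_axioms by (simp add: N)
  qed
  then show ?thesis
    unfolding output_laws_def by blast
qed

section \<open>Lower bound\<close>

text \<open>The condition says that \<open>x\<close> lies between the two outer zeros of the cubic.
  The cut keeps the function bounded, so that no design point, however remote, can reveal much about
  \<open>t\<close>.\<close>

definition clipped_cubic :: "real \<Rightarrow> real \<Rightarrow> real \<Rightarrow> real \<Rightarrow> real" where
  "clipped_cubic a t x0 x =
     (if (x - x0) ^ 2 \<le> 6 * t / a then t * (x - x0) - a / 6 * (x - x0) ^ 3 else 0)"

text \<open>\<open>x0\<close> is interior to the region where the cubic is uncut, so all derivatives
  there are those of the cubic.\<close>

lemma clipped_cubic_derivs:
  fixes a t x0 :: real
  assumes "a > 0" and "t > 0"
  defines "f \<equiv> clipped_cubic a t x0"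
  shows "\<forall>\<^sub>F x in nhds x0. f differentiable (at x)"
    and "deriv f differentiable (at x0)"
    and "deriv f x0 = t" and "(deriv ^^ 2) f x0 = 0"
proof -
  let ?p = "\<lambda>x. t * (x - x0) - a / 6 * (x - x0) ^ 3"
  let ?p' = "\<lambda>x. t - a / 2 * (x - x0) ^ 2"
  have "open {x. (x - x0) ^ 2 < 6 * t / a}"
    by (intro open_Collect_less continuous_intros)
  from eventually_nhds_in_open[OF this, of x0]
  have "\<forall>\<^sub>F x in nhds x0. (x - x0) ^ 2 < 6 * t / a"
    using assms by simp
  then have "\<forall>\<^sub>F x in nhds x0. f x = ?p x"
    by eventually_elim (simp add: f_def clipped_cubic_def)
  \<comment> \<open>Agreement around every nearby \<open>x\<close>, not only around
    \<open>x0\<close>, is what identifies \<open>deriv f\<close> on a neighbourhood and so permits a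
    second differentiation.\<close>
  then have "\<forall>\<^sub>F x in nhds x0. \<forall>\<^sub>F y in nhds x. f y = ?p y"
    by (simp add: eventually_eventually)
  then have D: "\<forall>\<^sub>F x in nhds x0. (f has_field_derivative ?p' x) (at x)"
  proof eventually_elim
    case (elim x)
    have "(?p has_field_derivative ?p' x) (at x)"
      by (auto intro!: derivative_eq_intros simp: power2_eq_square)
    then show ?case
      using DERIV_cong_ev[OF refl elim refl] by simp
  qed
  then show "\<forall>\<^sub>F x in nhds x0. f differentiable (at x)"
    by eventually_elim (auto simp: real_differentiable_def)
  have d1: "\<forall>\<^sub>F x in nhds x0. deriv f x = ?p' x"
    using D by eventually_elim (rule DERIV_imp_deriv)
  then show "deriv f x0 = t"
    by (auto dest: eventually_nhds_x_imp_x)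
  have "(?p' has_field_derivative 0) (at x0)"
    by (auto intro!: derivative_eq_intros)
  then have D2: "(deriv f has_field_derivative 0) (at x0)"
    using DERIV_cong_ev[OF refl d1 refl] by simp
  then show "deriv f differentiable (at x0)"
    by (auto simp: real_differentiable_def)
  show "(deriv ^^ 2) f x0 = 0"
    using DERIV_imp_deriv[OF D2] by (simp add: numeral_2_eq_2)
qed

text \<open>Where the cubic is uncut, the remainder has size exactly
  \<open>a / 6 * \<bar>x - x0\<bar> ^ 3\<close>. Beyond the cut it is
  \<open>t * \<bar>x - x0\<bar>\<close>, and there
  \<open>t \<le> a / 6 * (x - x0) ^ 2\<close>.\<close>

lemma clipped_cubic_in_func_class:
  assumes "a > 0" and "t > 0"
  shows "clipped_cubic a t x0 \<in> func_class a x0"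
proof -
  have "\<bar>clipped_cubic a t x0 x - t * (x - x0)\<bar> \<le> a / 6 * \<bar>x - x0\<bar> ^ 3" for x
  proof (cases "(x - x0) ^ 2 \<le> 6 * t / a")
    case True
    then show ?thesis
      using assms by (simp add: clipped_cubic_def abs_mult power_abs)
  next
    case False
    then have "t \<le> a / 6 * (x - x0) ^ 2"
      using assms by (simp add: field_simps)
    then have "t * \<bar>x - x0\<bar> \<le> a / 6 * (x - x0) ^ 2 * \<bar>x - x0\<bar>"
      by (rule mult_right_mono) simp
    also have "\<dots> = a / 6 * \<bar>x - x0\<bar> ^ 3"
      by (simp add: power3_eq_cube power2_eq_square abs_mult_self_eq mult.assoc)
    finally show ?thesis
      using False assms by (simp add: clipped_cubic_def abs_mult)
  qed
  moreover have "clipped_cubic a t x0 x0 = 0"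
    by (simp add: clipped_cubic_def)
  ultimately show ?thesis
    using clipped_cubic_derivs[OF assms, of x0] by (simp add: func_class_def)
qed

text \<open>In \<open>p = a * z ^ 2 / 6\<close> the square is
  \<open>6 / a * p * (t - p) ^ 2\<close>, which on \<open>0 \<le> p \<le> t\<close> is largest at
  \<open>p = t / 3\<close>.\<close>

lemma clipped_cubic_square_le:
  assumes "a > 0" and "t > 0"
  shows "clipped_cubic a t x0 x ^ 2 \<le> 8 * t ^ 3 / (9 * a)"
proof (cases "(x - x0) ^ 2 \<le> 6 * t / a")
  case True
  define z where "z = x - x0"
  define p where "p = a * z ^ 2 / 6"
  have p: "p \<le> t"
    using True assms by (simp add: p_def z_def field_simps)
  \<comment> \<open>The gap to the maximum factors with a double root at
    \<open>p = t / 3\<close>.\<close>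
  have "0 \<le> (t - 3 * p) ^ 2 * (4 * t - 3 * p)"
    using p assms by (intro mult_nonneg_nonneg) auto
  also have "\<dots> = 4 * t ^ 3 - 27 * (p * (t - p) ^ 2)"
    by (simp add: power2_eq_square power3_eq_cube algebra_simps)
  finally have *: "27 * (p * (t - p) ^ 2) \<le> 4 * t ^ 3" by simp
  have "clipped_cubic a t x0 x = z * (t - p)"
    using True
    by (simp add: clipped_cubic_def p_def power2_eq_square power3_eq_cube algebra_simps flip: z_def)
  then have "clipped_cubic a t x0 x ^ 2 = 6 * (p * (t - p) ^ 2) / a"
    using assms by (simp add: power_mult_distrib p_def)
  also have "\<dots> \<le> 8 * t ^ 3 / (9 * a)"
    using * assms by (simp add: field_simps)
  finally show ?thesis .
next
  case False
  then show ?thesis using assms by (simp add: clipped_cubic_def)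
qed

text \<open>The risk at the clipped cubic is \<open>(S - t) ^ 2 + b * W\<close>, and Cauchy-Schwarz
  gives \<open>S ^ 2 \<le> W * H\<close>. Minimising over \<open>S\<close> yields
  \<open>t ^ 2 * b / (b + H)\<close>; when \<open>H\<close> is proportional to \<open>t ^ 3\<close>,
  this is largest at \<open>H = 2 * b\<close>, hence the hypothesis and the value
  \<open>t ^ 2 / 3\<close>.\<close>

lemma linear_minimax_risk_ge:
  assumes "a > 0" and "b > 0" and "t > 0" and t: "real n * (8 * t ^ 3 / (9 * a)) \<le> 2 * b"
  shows "ennreal (t ^ 2 / 3) \<le> linear_minimax_risk a b x0 n"
proof -
  let ?f = "clipped_cubic a t x0"
  have "ennreal (t ^ 2 / 3) \<le> worst_case_mse a b x0 n \<delta> (linear_estimator n w)" for \<delta> w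
  proof -
    let ?\<mu> = "\<lambda>x. density lborel (normal_density (?f x) (sqrt b))"
    define S where "S = (\<Sum>j = 1..n. w j * ?f (x0 + \<delta> j))"
    define W where "W = (\<Sum>j = 1..n. w j ^ 2)"
    define H where "H = (\<Sum>j = 1..n. ?f (x0 + \<delta> j) ^ 2)"
    have "H \<le> (\<Sum>j = 1..n. 8 * t ^ 3 / (9 * a))"
      unfolding H_def by (intro sum_mono clipped_cubic_square_le assms)
    then have H: "H \<le> 2 * b" using t by simp
    have "S ^ 2 \<le> W * H"
      unfolding S_def W_def H_def by (rule Cauchy_Schwarz_ineq_sum)
    also have "\<dots> \<le> W * (2 * b)"
      using H by (intro mult_left_mono) (auto simp: W_def sum_nonneg)
    finally have SW: "S ^ 2 \<le> 2 * b * W" by (simp add: mult_ac)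
    \<comment> \<open>Completing the square: \<open>(S - t) ^ 2 + S ^ 2 / 2\<close> is minimal at
      \<open>S = 2 * t / 3\<close>.\<close>
    have "(S - t) ^ 2 + S ^ 2 / 2 - t ^ 2 / 3 = 3 / 2 * (S - 2 * t / 3) ^ 2"
      by (simp add: power2_eq_square field_simps)
    moreover have "0 \<le> 3 / 2 * (S - 2 * t / 3) ^ 2" by simp
    ultimately have "t ^ 2 / 3 \<le> (S - t) ^ 2 + b * W" using SW by linarith
    also have "b * W = (\<Sum>j = 1..n. w j ^ 2 * b)"
      by (simp add: W_def sum_distrib_left mult.commute)
    finally have "ennreal (t ^ 2 / 3)
        \<le> mse n x0 ?\<mu> (deriv ?f x0) \<delta> (linear_estimator n w)"
      unfolding mse_linear_estimator[OF normal_output_laws[OF assms(2)]] S_def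
      by (intro ennreal_leI) (simp add: clipped_cubic_derivs assms)
    also have "\<dots> \<le> worst_case_mse a b x0 n \<delta> (linear_estimator n w)"
      unfolding worst_case_mse_def
      using clipped_cubic_in_func_class[OF assms(1,3)] normal_output_laws[OF assms(2)] assms(2)
      by (intro SUP_upper2[where i = ?f] SUP_upper2[where i = "\<lambda>_. b"]
          SUP_upper2[where i = ?\<mu>]) (auto simp: var_class_def)
    finally show ?thesis .
  qed
  then show ?thesis
    unfolding linear_minimax_risk_def by (intro INF_greatest)
qed

section \<open>Upper bound\<close>

text \<open>\<open>f x0\<close> and the quadratic term \<open>q\<close> agree at
  \<open>x0 + d\<close> and \<open>x0 - d\<close> and cancel in the difference, leaving two cubic
  remainders.\<close>

lemma cfd_bias:
  assumes f: "f \<in> func_class a x0" and "d > 0"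
  shows "\<bar>(f (x0 + d) - f (x0 - d)) / (2 * d) - deriv f x0\<bar> \<le> a * d ^ 2 / 6"
proof -
  define q where "q = (deriv ^^ 2) f x0 / 2 * d ^ 2"
  have T: "\<bar>f x - f x0 - deriv f x0 * (x - x0) - (deriv ^^ 2) f x0 / 2 * (x - x0) ^ 2\<bar>
      \<le> a / 6 * \<bar>x - x0\<bar> ^ 3" for x
    using f by (simp add: func_class_def)
  have "\<bar>f (x0 + d) - f x0 - deriv f x0 * d - q\<bar> \<le> a / 6 * d ^ 3"
    using T[of "x0 + d"] assms by (simp add: q_def)
  moreover have "\<bar>f (x0 - d) - f x0 + deriv f x0 * d - q\<bar> \<le> a / 6 * d ^ 3"
    using T[of "x0 - d"] assms by (simp add: q_def)
  ultimately have "\<bar>f (x0 + d) - f (x0 - d) - 2 * (deriv f x0 * d)\<bar> \<le> a / 6 * d ^ 3 * 2"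
    by linarith
  then have "\<bar>f (x0 + d) - f (x0 - d) - 2 * (deriv f x0 * d)\<bar> / (2 * d) \<le> a / 6 * d ^ 3 * 2 / (2 * d)"
    using assms by (intro divide_right_mono) auto
  moreover have "(f (x0 + d) - f (x0 - d)) / (2 * d) - deriv f x0
      = (f (x0 + d) - f (x0 - d) - 2 * (deriv f x0 * d)) / (2 * d)"
    using assms by (simp add: diff_divide_distrib)
  ultimately show ?thesis
    using assms by (simp add: abs_divide power2_eq_square power3_eq_cube)
qed

text \<open>The weights are \<open>1 / (n * d)\<close> up to sign, so their squares sum to
  \<open>1 / (n * d ^ 2)\<close>; the bias is bounded by \<open>cfd_bias\<close>.\<close>

lemma cfd_worst_case_mse_le:
  assumes "d > 0" and "even n" and "n \<ge> 1"
  shows "worst_case_mse a b x0 n (cfd_design d) (cfd_estimator n d)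
    \<le> ennreal ((a * d ^ 2 / 6) ^ 2 + b / (real n * d ^ 2))"
  unfolding worst_case_mse_def
proof (intro SUP_least)
  fix f v \<mu> assume f: "f \<in> func_class a x0" and v: "v \<in> var_class b" and \<mu>: "\<mu> \<in> output_laws f v"
  let ?w = "\<lambda>j. (if odd j then 1 else -1) / (real n * d)"
  have "(\<Sum>j = 1..n. ?w j * f (x0 + cfd_design d j))
      = cfd_estimator n d (\<lambda>j. f (x0 + cfd_design d j))"
    unfolding cfd_estimator_linear[OF assms(2)] linear_estimator_def ..
  \<comment> \<open>Index \<open>2 * j - 1\<close> is odd and observes at \<open>x0 + d\<close>,
    index \<open>2 * j\<close> at \<open>x0 - d\<close>, so all \<open>n div 2\<close> summands
    coincide.\<close>
  also have "\<dots> = 1 / (real n / 2) * (\<Sum>j = 1..n div 2. (f (x0 + d) - f (x0 - d)) / (2 * d))"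
    unfolding cfd_estimator_def cfd_design_def by (intro arg_cong2[where f = "(*)"] sum.cong) auto
  also have "\<dots> = (f (x0 + d) - f (x0 - d)) / (2 * d)"
    using assms by (simp add: real_of_nat_div field_simps)
  finally have mean: "(\<Sum>j = 1..n. ?w j * f (x0 + cfd_design d j))
      = (f (x0 + d) - f (x0 - d)) / (2 * d)" .
  have "((\<Sum>j = 1..n. ?w j * f (x0 + cfd_design d j)) - deriv f x0) ^ 2 \<le> (a * d ^ 2 / 6) ^ 2"
    unfolding mean by (rule power2_le_iff_abs_le[THEN iffD2])
      (use cfd_bias[OF f assms(1)] in linarith)+
  moreover have "(\<Sum>j = 1..n. ?w j ^ 2 * v (x0 + cfd_design d j))
      \<le> (\<Sum>j = 1..n. (1 / (real n * d) ^ 2) * b)"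
    using v by (intro sum_mono mult_mono) (auto simp: var_class_def power_divide)
  moreover have "(\<Sum>j = 1..n. (1 / (real n * d) ^ 2) * b) = b / (real n * d ^ 2)"
    using assms by (simp add: power_mult_distrib power2_eq_square)
  ultimately show "mse n x0 \<mu> (deriv f x0) (cfd_design d) (cfd_estimator n d)
      \<le> ennreal ((a * d ^ 2 / 6) ^ 2 + b / (real n * d ^ 2))"
    unfolding cfd_estimator_linear[OF assms(2)] mse_linear_estimator[OF \<mu>]
    by (intro ennreal_leI add_mono) simp_all
qed

section \<open>Matching the two bounds\<close>

theorem theorem1:
  fixes a b x0 :: real and n :: nat
  assumes "a > 0" and "b > 0" and "n \<ge> 1"
  shows "linear_minimax_risk a b x0 n
           \<ge> ennreal ((3 * a ^ 2 * b ^ 2 / 16) powr (1 / 3) * real n powr (- 2 / 3)) \<and>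
         (even n \<longrightarrow>
           (let d = (18 * b / a ^ 2) powr (1 / 6) * real n powr (- 1 / 6) in
              worst_case_mse a b x0 n (cfd_design d) (cfd_estimator n d)
                = ennreal ((3 * a ^ 2 * b ^ 2 / 16) powr (1 / 3) * real n powr (- 2 / 3)) \<and>
              worst_case_mse a b x0 n (cfd_design d) (cfd_estimator n d)
                = linear_minimax_risk a b x0 n))"
proof -
  define V where "V = (3 * a ^ 2 * b ^ 2 / 16) powr (1 / 3) * real n powr (- 2 / 3)"
  define d where "d = (18 * b / a ^ 2) powr (1 / 6) * real n powr (- 1 / 6)"
  \<comment> \<open>This \<open>t\<close> turns the hypothesis of
    \<open>linear_minimax_risk_ge\<close> into an equality.\<close>
  define t where "t = root 3 (9 * a * b / (4 * real n))"
  have n: "real n > 0" using assms by simp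
  have V: "V > 0" and d: "d > 0" and t: "t > 0"
    using assms n by (simp_all add: V_def d_def t_def)
  \<comment> \<open>Fractional powers are compared through integer powers of \<open>V\<close>,
    \<open>d\<close> and \<open>t\<close>, which are rational in \<open>a\<close>, \<open>b\<close>
    and \<open>n\<close>.\<close>
  have V3: "V ^ 3 = 3 * a ^ 2 * b ^ 2 / (16 * real n ^ 2)"
  proof -
    have "real n powr (- 2) = 1 / real n ^ 2"
      using n by (simp add: powr_minus_divide)
    then show ?thesis
      using assms n by (simp add: V_def power_mult_distrib powr_power)
  qed
  have d6: "d ^ 6 = 18 * b / (a ^ 2 * real n)"
  proof -
    have "real n powr (- 1) = 1 / real n"
      using n by (simp add: powr_minus_divide)
    then show ?thesis
      using assms n by (simp add: d_def power_mult_distrib powr_power)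
  qed
  have t3: "t ^ 3 = 9 * a * b / (4 * real n)"
    using assms by (simp add: t_def real_root_pow_pos2)
  have "(t ^ 2 / 3) ^ 3 = (t ^ 3) ^ 2 / 27"
    by (simp add: power_divide flip: power_mult)
  also have "\<dots> = V ^ 3"
    unfolding t3 V3 using n by (simp add: field_simps power2_eq_square)
  finally have tV: "t ^ 2 / 3 = V"
    by (rule power_eq_imp_eq_base) (use V in auto)
  have "ennreal (t ^ 2 / 3) \<le> linear_minimax_risk a b x0 n"
    by (rule linear_minimax_risk_ge) (use assms t n t3 in \<open>auto simp: field_simps\<close>)
  then have lower: "ennreal V \<le> linear_minimax_risk a b x0 n"
    by (simp add: tV)
  have upper: "worst_case_mse a b x0 n (cfd_design d) (cfd_estimator n d) \<le> ennreal V"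
    if "even n"
  proof -
    \<comment> \<open>With this \<open>d\<close> the variance bound is
      \<open>a ^ 2 * d ^ 4 / 18\<close>, twice the squared bias bound; this ratio marks the minimum
      of their sum over \<open>d\<close>.\<close>
    have bn: "b / real n = a ^ 2 * d ^ 6 / 18"
      unfolding d6 using assms n by simp
    have "b / (real n * d ^ 2) = b / real n / d ^ 2"
      by simp
    also have "\<dots> = a ^ 2 * d ^ 4 / 18"
      unfolding bn using d by (simp add: power2_eq_square eval_nat_numeral)
    finally have val: "(a * d ^ 2 / 6) ^ 2 + b / (real n * d ^ 2) = a ^ 2 * d ^ 4 / 12"
      by (simp add: power2_eq_square eval_nat_numeral)
    have "(a ^ 2 * d ^ 4 / 12) ^ 3 = a ^ 6 * (d ^ 6) ^ 2 / 1728"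
      by (simp add: power_divide power_mult_distrib flip: power_mult)
    also have "\<dots> = V ^ 3"
      unfolding d6 V3 using assms n by (simp add: field_simps eval_nat_numeral)
    finally have "a ^ 2 * d ^ 4 / 12 = V"
      by (rule power_eq_imp_eq_base) (use V in auto)
    then show ?thesis
      using cfd_worst_case_mse_le[OF d that assms(3), of a b x0] by (simp add: val)
  qed
  \<comment> \<open>The CFD design and weights compete in the infimum. For even \<open>n\<close>
    this closes the chain from \<open>V\<close> through the minimax risk and the CFD worst case back
    to \<open>V\<close>, so all are equal.\<close>
  have "linear_minimax_risk a b x0 n
      \<le> worst_case_mse a b x0 n (cfd_design d) (cfd_estimator n d)" if "even n"
    unfolding linear_minimax_risk_def cfd_estimator_linear[OF that]
    by (rule INF_lower2[where i = "cfd_design d"], simp)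
      (rule INF_lower2[where i = "\<lambda>j. (if odd j then 1 else -1) / (real n * d)"], simp_all)
  with lower upper show ?thesis
    unfolding Let_def V_def[symmetric] d_def[symmetric] by (meson antisym order_trans)
qed

end
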